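(* For every integer $n\ge 0$, the $n$th moment $\mu_n(c)$ of the associated Hermite polynomials is the generating function for complete matchings of $[n]$ (the sum over all complete matchings of the product of the weights of their edges), where the edges are weighted in either of the following two ways: (1) edges that are not nested by any other edge have weight $c$, and all other edges have weight $1$; or (2) edges with no right crossings have weight $c$, and all other edges have weight $1$. That is, the sum under weighting (1) and the sum under weighting (2) are each equal to $\mu_n(c)$.
   Context: $c$ is an indeterminate. The associated Hermite polynomials are defined by $H_0(x;c)=1$, $H_m(x;c)=0$ for $m<0$, and $H_{n+1}(x;c)=xH_n(x;c)-(n-1+c)H_{n-1}(x;c)$ for $n\ge0$. Their moments $\mu_n(c)=\mathcal{L}_c(x^n)$ are given (by Viennot's theory of orthogonal polynomials) by $\mu_n(c)=\sum_P wt(P)$, where $P$ runs over Dyck paths of length $n$ (paths with $n$ steps, each northeast or southeast, from height $0$ to height $0$, never going below height $0$), and $wt(P)$ is the product of its step weights, a northeast step having weight $1$ and a southeast step leaving from height $j$ having weight $j-1+c$. So $\mu_n(c)=0$ for odd $n$. A complete matching of $[n]=\{1,\dots,n\}$ is a partition of $[n]$ into blocks of size $2$ (edges), written $(a,b)$ with $a<b$. The edge $(a,b)$ is nested by $(a',b')$ if $a'<a<b<b'$. The edge $(a,b)$ has a right crossing if there is an edge $(a',b')$ with $a<a'<b<b'$. *)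

theory Defs
  imports
    "HOL-Computational_Algebra.Polynomial"
    "HOL-Library.Disjoint_Sets"
begin

section \<open>Associated Hermite polynomials and their moments\<close>

text \<open>The indeterminate \<open>c\<close> is the generator of \<open>\<int>[c]\<close>; polynomials in \<open>x\<close> over \<open>\<int>[c]\<close> have
  type \<^typ>\<open>int poly poly\<close>.\<close>

abbreviation indet_c :: "int poly" where
  "indet_c \<equiv> monom 1 (Suc 0)"

abbreviation indet_x :: "int poly poly" where
  "indet_x \<equiv> monom 1 (Suc 0)"

text \<open>The instance \<open>n = 0\<close> of the recurrence \<open>H\<^sub>n\<^sub>+\<^sub>1 = x H\<^sub>n - (n - 1 + c) H\<^sub>n\<^sub>-\<^sub>1\<close> together with
  \<open>H\<^sub>-\<^sub>1 = 0\<close> gives the second equation.\<close>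

fun assoc_hermite :: "nat \<Rightarrow> int poly poly" where
  "assoc_hermite 0 = 1"
| "assoc_hermite (Suc 0) = indet_x * assoc_hermite 0"
| "assoc_hermite (Suc (Suc n)) =
     indet_x * assoc_hermite (Suc n) - smult (of_nat (Suc n) - 1 + indet_c) (assoc_hermite n)"

definition is_moment_functional :: "(nat \<Rightarrow> 'a::comm_ring_1 poly) \<Rightarrow> ('a poly \<Rightarrow> 'a) \<Rightarrow> bool" where
  "is_moment_functional P L \<longleftrightarrow>
     module_hom smult (*) L \<and> L 1 = 1 \<and>
     (\<forall>m n. m \<noteq> n \<longrightarrow> L (P m * P n) = 0) \<and> (\<forall>n. L (P n * P n) \<noteq> 0)"

text \<open>Existence and uniqueness are shown in \<open>ex1_moment_functional\<close> below.\<close>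

definition assoc_hermite_functional :: "int poly poly \<Rightarrow> int poly" where
  "assoc_hermite_functional = (THE L. is_moment_functional assoc_hermite L)"

definition assoc_hermite_moment :: "nat \<Rightarrow> int poly" where
  "assoc_hermite_moment n = assoc_hermite_functional (indet_x ^ n)"

section \<open>Complete matchings\<close>

definition complete_matchings :: "nat \<Rightarrow> nat set set set" where
  "complete_matchings n = {M. partition_on {1..n} M \<and> (\<forall>e\<in>M. card e = 2)}"

text \<open>An edge \<open>(a, b)\<close> with \<open>a < b\<close> is the set \<open>e = {a, b}\<close>, so \<open>a = Min e\<close> and \<open>b = Max e\<close>.\<close>

definition nested_by :: "nat set \<Rightarrow> nat set \<Rightarrow> bool" where
  "nested_by e e' \<longleftrightarrow> Min e' < Min e \<and> Max e < Max e'"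

definition right_crossed_by :: "nat set \<Rightarrow> nat set \<Rightarrow> bool" where
  "right_crossed_by e e' \<longleftrightarrow> Min e < Min e' \<and> Min e' < Max e \<and> Max e < Max e'"

definition nesting_weight :: "nat set set \<Rightarrow> nat set \<Rightarrow> int poly" where
  "nesting_weight M e = (if \<exists>e'\<in>M. nested_by e e' then 1 else indet_c)"

definition crossing_weight :: "nat set set \<Rightarrow> nat set \<Rightarrow> int poly" where
  "crossing_weight M e = (if \<exists>e'\<in>M. right_crossed_by e e' then 1 else indet_c)"

section \<open>Viennot's formula for the moments\<close>

datatype step = NE | SE

text \<open>The natural number argument is the height at which the path starts.\<close>

fun dyck_from :: "nat \<Rightarrow> step list \<Rightarrow> bool" where
  "dyck_from h [] \<longleftrightarrow> h = 0"
| "dyck_from h (NE # P) \<longleftrightarrow> dyck_from (Suc h) P"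
| "dyck_from h (SE # P) \<longleftrightarrow> h > 0 \<and> dyck_from (h - 1) P"

fun path_weight :: "nat \<Rightarrow> step list \<Rightarrow> int poly" where
  "path_weight h [] = 1"
| "path_weight h (NE # P) = path_weight (Suc h) P"
| "path_weight h (SE # P) = (of_nat h - 1 + indet_c) * path_weight (h - 1) P"

definition path_sum :: "nat \<Rightarrow> nat \<Rightarrow> int poly" where
  "path_sum h n = (\<Sum>P | length P = n \<and> dyck_from h P. path_weight h P)"

lemma finite_paths: "finite {P. length P = n \<and> dyck_from h P}"
proof -
  have "(UNIV :: step set) = {NE, SE}" using step.exhaust by auto
  then have "finite (UNIV :: step set)" by (metis finite.emptyI finite_insert)
  then have "finite {P :: step list. set P \<subseteq> UNIV \<and> length P = n}" by (rule finite_lists_length_eq)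
  then show ?thesis by (rule rev_finite_subset) auto
qed

lemma path_sum_0: "path_sum h 0 = (if h = 0 then 1 else 0)"
proof -
  have "{P. length P = 0 \<and> dyck_from h P} = (if h = 0 then {[]} else {})" by auto
  then show ?thesis by (simp add: path_sum_def)
qed

lemma path_sum_Suc:
  "path_sum h (Suc n) = path_sum (Suc h) n +
     (if h = 0 then 0 else (of_nat h - 1 + indet_c) * path_sum (h - 1) n)"
proof -
  let ?S = "\<lambda>h. {P. length P = n \<and> dyck_from h P}"
  let ?A = "Cons NE ` ?S (Suc h)"
  let ?B = "if h = 0 then {} else Cons SE ` ?S (h - 1)"
  have "P \<in> ?A \<union> ?B" if "length P = Suc n" "dyck_from h P" for P
    using that by (cases "(h, P)" rule: dyck_from.cases) auto
  moreover have "length P = Suc n \<and> dyck_from h P" if "P \<in> ?A \<union> ?B" for P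
    using that by (auto split: if_splits)
  ultimately have "{P. length P = Suc n \<and> dyck_from h P} = ?A \<union> ?B" by blast
  then have "path_sum h (Suc n) = sum (path_weight h) (?A \<union> ?B)"
    by (simp only: path_sum_def)
  also have "\<dots> = sum (path_weight h) ?A + sum (path_weight h) ?B"
    by (rule sum.union_disjoint) (auto simp: finite_paths)
  also have "sum (path_weight h) ?A = path_sum (Suc h) n"
    by (simp add: sum.reindex path_sum_def)
  also have "sum (path_weight h) ?B =
      (if h = 0 then 0 else (of_nat h - 1 + indet_c) * path_sum (h - 1) n)"
    by (simp add: sum.reindex path_sum_def sum_distrib_left)
  finally show ?thesis .
qed

lemma path_sum_less: "n < h \<Longrightarrow> path_sum h n = 0"
  by (induction n arbitrary: h) (auto simp: path_sum_0 path_sum_Suc)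

lemma path_sum_diag: "path_sum h h \<noteq> 0"
proof (induction h)
  case 0
  then show ?case by (simp add: path_sum_0)
next
  case (Suc h)
  have "(of_nat (Suc h) - 1 + indet_c :: int poly) \<noteq> 0"
  proof
    assume "(of_nat (Suc h) - 1 + indet_c :: int poly) = 0"
    then have "coeff (of_nat (Suc h) - 1 + indet_c :: int poly) 1 = 0" by simp
    then show False by (simp add: coeff_eq_0 of_nat_poly)
  qed
  with Suc show ?case by (simp add: path_sum_Suc[of "Suc h" h] path_sum_less)
qed

lemma assoc_hermite_mult_x:
  "indet_x * assoc_hermite k = assoc_hermite (Suc k) +
     (if k = 0 then 0 else smult (of_nat k - 1 + indet_c) (assoc_hermite (k - 1)))"
  by (cases k) simp_all

lemma assoc_hermite_Suc_mult_x_power: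
  "assoc_hermite (Suc j) * indet_x ^ n = assoc_hermite j * indet_x ^ Suc n -
     (if j = 0 then 0 else smult (of_nat j - 1 + indet_c) (assoc_hermite (j - 1) * indet_x ^ n))"
proof -
  have *: "h * x ^ n = g * x ^ Suc n - (if b then 0 else smult a (k * x ^ n))"
    if "h = x * g - (if b then 0 else smult a k)" for h x g k :: "int poly poly" and a b
    using that by (cases b) (simp_all add: left_diff_distrib mult.left_commute mult.assoc)
  show ?thesis
    by (rule *) (simp only: assoc_hermite_mult_x add_diff_cancel_right')
qed

lemma coeff_assoc_hermite: "i \<ge> n \<Longrightarrow> coeff (assoc_hermite n) i = (if i = n then 1 else 0)"
proof (induction n arbitrary: i rule: assoc_hermite.induct)
  case (3 n)
  then obtain j where "i = Suc j" by (cases i) auto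
  with 3 show ?case by (auto simp: coeff_monom_mult)
qed (auto simp: coeff_monom_mult coeff_eq_0)

lemma module_hom_expand:
  fixes L :: "int poly poly \<Rightarrow> int poly"
  assumes "module_hom smult (*) L"
  shows "L (p * q) = (\<Sum>i\<le>degree q. coeff q i * L (p * indet_x ^ i))"
proof -
  interpret module_hom smult "(*)" L by fact
  have "p * q = (\<Sum>i\<le>degree q. smult (coeff q i) (p * indet_x ^ i))"
    by (subst (1) poly_as_sum_of_monoms[of q, symmetric])
       (simp add: sum_distrib_left monom_power flip: smult_monom mult_smult_right
          add: smult_monom)
  then show ?thesis by (simp add: sum scale)
qed

lemma functional_mult_x_power:
  assumes "module_hom smult (*) L" "L 1 = 1" "\<And>n. n > 0 \<Longrightarrow> L (assoc_hermite n) = 0"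
  shows "L (assoc_hermite k * indet_x ^ n) = path_sum k n"
proof (induction n arbitrary: k)
  case 0
  then show ?case using assms(2,3) by (cases k) (auto simp: path_sum_0)
next
  case (Suc n)
  interpret module_hom smult "(*)" L by fact
  have "assoc_hermite k * indet_x ^ Suc n = (indet_x * assoc_hermite k) * indet_x ^ n"
    by (simp add: algebra_simps)
  also have "\<dots> = assoc_hermite (Suc k) * indet_x ^ n + (if k = 0 then 0 else
      smult (of_nat k - 1 + indet_c) (assoc_hermite (k - 1) * indet_x ^ n))"
    by (simp only: assoc_hermite_mult_x) (simp add: algebra_simps)
  also have "L \<dots> = path_sum k (Suc n)"
    by (simp add: add scale zero Suc.IH path_sum_Suc[of k n] del: assoc_hermite.simps)
  finally show ?case .
qed

lemma moment_functional_x_power: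
  assumes "is_moment_functional assoc_hermite L"
  shows "L (indet_x ^ n) = path_sum 0 n"
proof -
  have "L (assoc_hermite m) = 0" if "m > 0" for m
  proof -
    from assms that have "L (assoc_hermite m * assoc_hermite 0) = 0"
      unfolding is_moment_functional_def by blast
    then show ?thesis by simp
  qed
  then have "L (assoc_hermite 0 * indet_x ^ n) = path_sum 0 n"
    using assms by (intro functional_mult_x_power) (auto simp: is_moment_functional_def)
  then show ?thesis by simp
qed

lemma moment_functional_exists:
  "\<exists>L. is_moment_functional assoc_hermite L"
proof -
  define L :: "int poly poly \<Rightarrow> int poly"
    where "L p = (\<Sum>i\<le>degree p. coeff p i * path_sum 0 i)" for p
  have L_le: "L p = (\<Sum>i\<le>N. coeff p i * path_sum 0 i)" if "degree p \<le> N" for p N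
    unfolding L_def using that by (intro sum.mono_neutral_left) (auto simp: coeff_eq_0)
  have hom: "module_hom smult (*) L"
  proof
    fix p q :: "int poly poly" and a :: "int poly"
    let ?N = "max (degree p) (degree q)"
    have "degree (p + q) \<le> ?N" by (rule degree_add_le_max)
    then have "L (p + q) = (\<Sum>i\<le>?N. coeff (p + q) i * path_sum 0 i)" by (rule L_le)
    also have "\<dots> = L p + L q"
      by (simp add: L_le[of p ?N] L_le[of q ?N] sum.distrib algebra_simps)
    finally show "L (p + q) = L p + L q" .
    show "L (smult a p) = a * L p"
      using L_le[of "smult a p" "degree p"]
      by (simp add: degree_smult_le L_def sum_distrib_left algebra_simps)
  qed (simp_all add: algebra_simps smult_add_left smult_add_right)
  interpret module_hom smult "(*)" L by (rule hom)
  have L_x: "L (indet_x ^ n) = path_sum 0 n" for n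
  proof -
    have "L (indet_x ^ n) = (\<Sum>i\<le>n. coeff (monom 1 n) i * path_sum 0 i)"
      by (simp add: monom_power L_le[of "monom 1 n" n] degree_monom_le)
    also have "\<dots> = (\<Sum>i\<le>n. if i = n then path_sum 0 i else 0)"
      by (intro sum.cong) auto
    finally show ?thesis by simp
  qed
  have rec: "L (assoc_hermite k * indet_x ^ n) = path_sum k n" for k n
  proof (induction k arbitrary: n rule: less_induct)
    case (less k)
    show ?case
    proof (cases k)
      case 0
      then show ?thesis by (simp add: L_x)
    next
      case (Suc j)
      have "L (assoc_hermite (Suc j) * indet_x ^ n) = L (assoc_hermite j * indet_x ^ Suc n) -
          (if j = 0 then 0 else (of_nat j - 1 + indet_c) * L (assoc_hermite (j - 1) * indet_x ^ n))"
        unfolding assoc_hermite_Suc_mult_x_power diff if_distrib[of L] zero scale ..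
      also have "\<dots> = path_sum k n"
        using less.IH[of j "Suc n"] less.IH[of "j - 1" n] Suc
        by (simp add: path_sum_Suc[of j n])
      finally show ?thesis using Suc by simp
    qed
  qed
  have deg: "degree (assoc_hermite m) = m" for m
    by (rule antisym) (auto intro!: degree_le le_degree simp: coeff_assoc_hermite)
  have expand: "L (assoc_hermite k * assoc_hermite m) =
      (\<Sum>i\<le>m. coeff (assoc_hermite m) i * path_sum k i)" for k m
    by (subst module_hom_expand[OF hom]) (simp only: rec deg)
  have orth_less: "L (assoc_hermite k * assoc_hermite m) = 0" if "m < k" for k m
    using that unfolding expand
    by (intro sum.neutral) (simp add: path_sum_less)
  have "L (assoc_hermite m * assoc_hermite n) = 0" if "m \<noteq> n" for m n
    using that orth_less[of m n] orth_less[of n m] by (cases m n rule: linorder_cases) (auto simp: mult.commute)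
  moreover have "L (assoc_hermite n * assoc_hermite n) \<noteq> 0" for n
  proof -
    have "L (assoc_hermite n * assoc_hermite n) =
        (\<Sum>i\<le>n. if i = n then path_sum n i else 0)"
      unfolding expand
      by (intro sum.cong) (auto simp: path_sum_less coeff_assoc_hermite)
    then show ?thesis by (simp add: path_sum_diag)
  qed
  moreover have "L 1 = 1"
    using L_x[of 0] by (simp add: path_sum_0)
  ultimately show ?thesis
    using hom unfolding is_moment_functional_def by blast
qed

lemma ex1_moment_functional: "\<exists>!L. is_moment_functional assoc_hermite L"
proof -
  have "L = L'" if "is_moment_functional assoc_hermite L" "is_moment_functional assoc_hermite L'" for L L'
  proof
    fix p
    have "module_hom smult (*) L" "module_hom smult (*) L'"
      using that by (simp_all add: is_moment_functional_def)
    from this[THEN module_hom_expand, of 1 p] show "L p = L' p"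
      by (simp add: that[THEN moment_functional_x_power])
  qed
  with moment_functional_exists show ?thesis by blast
qed

theorem assoc_hermite_moment_eq_dyck_sum:
  "assoc_hermite_moment n = (\<Sum>P | length P = n \<and> dyck_from 0 P. path_weight 0 P)"
  using moment_functional_x_power[OF theI'[OF ex1_moment_functional], of n]
  by (simp add: assoc_hermite_moment_def assoc_hermite_functional_def path_sum_def)

end

(* Read a complete matching from left to right. A closing point reached while j edges are open may
   close any of them, and every edge still open then ends further right. The edge that is closed is
   therefore not nested iff its left end is the least open point, and has no right crossing iff its
   left end is the greatest open point. In either case exactly one of the j choices has weight c,
   which gives the weight j - 1 + c of a southeast step leaving from height j. *)

theory Submission
  imports Defs
begin

text \<open>Completions of a matching that has been read up to the point \<open>m - 1\<close>: \<open>S\<close> is the set of left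
  ends of the edges that are still open, and the points \<open>m, \<dots>, m + n - 1\<close> are still unread.\<close>

definition completions :: "nat set \<Rightarrow> nat \<Rightarrow> nat \<Rightarrow> nat set set set" where
  "completions S m n =
     {M. partition_on (S \<union> {m..<m + n}) M \<and> (\<forall>e\<in>M. card e = 2 \<and> \<not> e \<subseteq> S)}"

text \<open>Common form of \<open>nesting_weight\<close> and \<open>crossing_weight\<close>, so that
  one induction serves both.\<close>

definition rel_weight :: "(nat set \<Rightarrow> nat set \<Rightarrow> bool) \<Rightarrow> nat set set \<Rightarrow> nat set \<Rightarrow> int poly" where
  "rel_weight R M e = (if \<exists>e'\<in>M. R e e' then 1 else indet_c)"

lemma finite_completions: "finite S \<Longrightarrow> finite (completions S m n)"
  by (rule finite_subset[of _ "Pow (Pow (S \<union> {m..<m + n}))"])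
     (auto simp: completions_def partition_on_def)

lemma finite_completion: "M \<in> completions S m n \<Longrightarrow> finite S \<Longrightarrow> finite M"
  by (auto simp: completions_def intro: finite_elements)

lemma completions_0: "completions S m 0 = (if S = {} then {{}} else {})"
  by (auto simp: completions_def partition_on_def)

text \<open>With no open points, \<open>\<not> e \<subseteq> S\<close> only says that
  \<open>e\<close> is nonempty, which \<open>card e = 2\<close> implies.\<close>

lemma complete_matchings_eq_completions: "complete_matchings n = completions {} 1 n"
  by (auto simp: complete_matchings_def completions_def atLeastLessThanSuc_atLeastAtMost)

lemma completion_edge_subset:
  "M \<in> completions S m n \<Longrightarrow> e \<in> M \<Longrightarrow> e \<subseteq> S \<union> {m..<m + n}"
  by (auto simp: completions_def partition_on_def)

text \<open>An edge not inside \<open>S\<close> has an unread point. Applied once \<open>m\<close>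
  has been read, this makes every remaining edge end beyond \<open>m\<close>.\<close>

lemma completion_edge_Max:
  assumes "M \<in> completions S m n" "e \<in> M" "finite S"
  shows "m \<le> Max e"
proof -
  from assms obtain x where "x \<in> e" "x \<notin> S" by (auto simp: completions_def)
  moreover have "finite e"
    using completion_edge_subset[OF assms(1,2)] by (rule finite_subset) (simp add: assms(3))
  moreover from calculation have "m \<le> x"
    using completion_edge_subset[OF assms(1,2)] by auto
  ultimately show ?thesis
    using Max_ge order_trans by blast
qed

text \<open>The two parts correspond to \<open>m\<close> opening an edge (northeast step) or closing
  the edge of an open point \<open>s\<close> (southeast step).\<close>

lemma completions_Suc:
  assumes S: "\<And>s. s \<in> S \<Longrightarrow> s < m"
  shows "completions S m (Suc n) = completions (insert m S) (Suc m) n \<union>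
           (\<Union>s\<in>S. insert {s, m} ` completions (S - {s}) (Suc m) n)" (is "?L = ?A \<union> ?B")
proof -
  have V: "S \<union> {m..<m + Suc n} = insert m S \<union> {Suc m..<Suc m + n}" by auto
  have mS: "m \<notin> S" using S by blast
  have ins: "insert {s, m} N \<in> ?L" if s: "s \<in> S" and N: "N \<in> completions (S - {s}) (Suc m) n" for s N
  proof -
    have U: "\<Union>N = (S - {s}) \<union> {Suc m..<Suc m + n}"
      using N by (auto simp: completions_def partition_on_def)
    then have "disjnt {s, m} (\<Union>N)" using S[OF s] mS by (simp add: disjnt_def)
    moreover have "(insert m S \<union> {Suc m..<Suc m + n}) - {s, m} = (S - {s}) \<union> {Suc m..<Suc m + n}"
      using S[OF s] mS by auto
    \<comment> \<open>No edge of \<open>N\<close> covers \<open>s\<close>, so an edge inside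
      \<open>S\<close> would already lie inside \<open>S - {s}\<close>.\<close>
    moreover have "\<not> e \<subseteq> S" if "e \<in> N" for e
    proof -
      have "s \<notin> \<Union>N" using U S[OF s] by auto
      moreover have "\<not> e \<subseteq> S - {s}" using N that by (simp add: completions_def)
      ultimately show ?thesis using that by blast
    qed
    ultimately show ?thesis
      using N s mS S[OF s] unfolding completions_def V
      by (simp add: partition_on_insert)
  qed
  have "?L \<subseteq> ?A \<union> ?B"
  proof
    fix M assume M: "M \<in> ?L"
    show "M \<in> ?A \<union> ?B"
    \<comment> \<open>An edge of \<open>M\<close> inside \<open>insert m S\<close> must be the one
      that \<open>m\<close> closes; if there is none, \<open>m\<close> stays open.\<close>
    proof (cases "\<exists>e\<in>M. e \<subseteq> insert m S")
      case False
      with M show ?thesis unfolding completions_def V by blast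
    next
      case True
      then obtain e where e: "e \<in> M" "e \<subseteq> insert m S" by blast
      with M have c: "card e = 2" "\<not> e \<subseteq> S" by (auto simp: completions_def)
      then have "m \<in> e" using e by blast
      with c obtain s where es: "e = {s, m}" "s \<noteq> m"
        by (auto simp: card_2_iff)
      then have s: "s \<in> S" using e by auto
      let ?N = "M - {e}"
      have Me: "M = insert e ?N" using e by auto
      have part: "partition_on (S \<union> {m..<m + Suc n}) M" using M by (simp add: completions_def)
      then have "disjnt e (\<Union>?N)"
        using e(1) by (fastforce simp: partition_on_def disjnt_def disjoint_def)
      with part Me have "partition_on ((S \<union> {m..<m + Suc n}) - e) ?N"
        by (metis partition_on_insert)
      moreover have "(S \<union> {m..<m + Suc n}) - e = (S - {s}) \<union> {Suc m..<Suc m + n}"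
        using S[OF s] mS es by auto
      ultimately have "?N \<in> completions (S - {s}) (Suc m) n"
        using M by (auto simp: completions_def)
      with s es Me show ?thesis by blast
    qed
  qed
  moreover have "?A \<subseteq> ?L" unfolding completions_def V by blast
  ultimately show ?thesis using ins by blast
qed

text \<open>Both \<open>nested_by\<close> and \<open>right_crossed_by\<close> have the form of \<open>R\<close>, with \<open>Q\<close> being \<open>>\<close>
  and \<open><\<close>, respectively. The point \<open>t\<close> in the last assumption is the only open point whose closure has
  weight \<open>c\<close>.\<close>

lemma sum_completions_eq_path_sum:
  fixes Q :: "nat \<Rightarrow> nat \<Rightarrow> bool"
  assumes R: "\<And>e e'. card e = 2 \<Longrightarrow> R e e' \<longleftrightarrow> Max e < Max e' \<and> Min e' < Max e \<and> Q (Min e) (Min e')"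
    and irrefl: "\<And>s. \<not> Q s s"
    and extremal: "\<And>S. finite S \<Longrightarrow> S \<noteq> {} \<Longrightarrow> \<exists>t\<in>S. \<forall>s\<in>S. (\<exists>s'\<in>S. Q s s') \<longleftrightarrow> s \<noteq> t"
  shows "finite S \<Longrightarrow> (\<And>s. s \<in> S \<Longrightarrow> s < m) \<Longrightarrow>
    (\<Sum>M\<in>completions S m n. \<Prod>e\<in>M. rel_weight R M e) = path_sum (card S) n"
proof (induction n arbitrary: S m)
  case 0
  then show ?case by (simp add: completions_0 path_sum_0)
next
  case (Suc n)
  let ?w = "\<lambda>M. \<Prod>e\<in>M. rel_weight R M e"
  \<comment> \<open>\<open>?q s\<close> is the weight of the edge \<open>{s, m}\<close>: it depends
    on the open points alone, not on how the remaining points are matched.\<close>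
  let ?q = "\<lambda>s. if \<exists>s'\<in>S. Q s s' then 1 else indet_c"
  let ?N = "\<lambda>s. completions (S - {s}) (Suc m) n"
  let ?A = "completions (insert m S) (Suc m) n"
  let ?B = "\<Union>s\<in>S. insert {s, m} ` ?N s"
  note fin = \<open>finite S\<close>
  note lt = Suc.prems(2)
  have notin: "m \<notin> e" if "s \<in> S" "M \<in> ?N s" "e \<in> M" for s M e
    using completion_edge_subset[OF that(2,3)] lt by fastforce
  have weight: "?w (insert {s, m} M) = ?q s * ?w M" if s: "s \<in> S" and M: "M \<in> ?N s" for s M
  proof -
    have sm: "s < m" using lt[OF s] .
    have mm: "Min {s, m} = s" "Max {s, m} = m" "card {s, m} = 2"
      using sm by (auto simp: min_def max_def)
    \<comment> \<open>\<open>R\<close> requires its second edge to end later, but all edges of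
      \<open>M\<close> end after \<open>m\<close>. So adding \<open>{s, m}\<close> leaves their
      weights unchanged.\<close>
    have "\<not> R e {s, m}" if "e \<in> M" for e
      using completion_edge_Max[OF M that] fin M that by (auto simp: R mm completions_def)
    then have same: "rel_weight R (insert {s, m} M) e = rel_weight R M e" if "e \<in> M" for e
      using that by (auto simp: rel_weight_def)
    have U: "\<Union>M = (S - {s}) \<union> {Suc m..<Suc m + n}"
      using M by (auto simp: completions_def partition_on_def)
    \<comment> \<open>The edges of \<open>M\<close> that start before \<open>m\<close> are those of
      the points in \<open>S - {s}\<close>, and all end after \<open>m\<close>; only the
      \<open>Q\<close> part of \<open>R\<close> is left to decide.\<close>
    have "(\<exists>e'\<in>insert {s, m} M. R {s, m} e') \<longleftrightarrow> (\<exists>s'\<in>S. Q s s')"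
    proof
      assume "\<exists>e'\<in>insert {s, m} M. R {s, m} e'"
      then obtain e where e: "e \<in> M" "Min e < m" "Q s (Min e)"
        by (auto simp: R mm)
      have "card e = 2" using M e by (auto simp: completions_def)
      then have "Min e \<in> e" by (intro Min_in) (auto intro: card_ge_0_finite)
      with e U have "Min e \<in> S" by fastforce
      with e show "\<exists>s'\<in>S. Q s s'" by blast
    next
      assume "\<exists>s'\<in>S. Q s s'"
      then obtain s' where s': "s' \<in> S" "Q s s'" by blast
      \<comment> \<open>Irreflexivity excludes \<open>s' = s\<close>, the one open point that
        \<open>M\<close> does not cover.\<close>
      with irrefl U have "s' \<in> \<Union>M" by auto
      then obtain e where e: "e \<in> M" "s' \<in> e" by blast
      then have c: "card e = 2" "\<not> e \<subseteq> S - {s}" using M by (auto simp: completions_def)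
      then obtain t where t: "t \<in> e" "t \<notin> S - {s}" by blast
      then have "t > m" using U e by fastforce
      moreover have "s' < m" using lt s' by simp
      moreover have "e = {s', t}"
        using c(1) e(2) t(1) calculation by (auto simp: card_2_iff)
      ultimately have "R {s, m} e" using s' by (auto simp: R mm)
      with e show "\<exists>e'\<in>insert {s, m} M. R {s, m} e'" by blast
    qed
    then have "rel_weight R (insert {s, m} M) {s, m} = ?q s"
      by (simp add: rel_weight_def)
    moreover have "{s, m} \<notin> M" using notin[OF s M] by blast
    moreover have "finite M" using finite_completion[OF M] fin by simp
    ultimately show ?thesis by (simp add: same)
  qed
  \<comment> \<open>The edge \<open>{s, m}\<close> lies inside \<open>insert m S\<close>, which
    members of \<open>?A\<close> forbid.\<close>
  have "insert {s, m} M \<notin> ?A" if "s \<in> S" for s M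
    using that by (simp add: completions_def)
  then have disj: "?A \<inter> ?B = {}" by blast
  have finB: "finite (insert {s, m} ` ?N s)" for s
    using fin by (simp add: finite_completions)
  have disjB: "insert {s, m} ` ?N s \<inter> insert {s', m} ` ?N s' = {}"
    if "s \<in> S" "s' \<in> S" "s \<noteq> s'" for s s'
  proof -
    have False if "M \<in> ?N s" "M' \<in> ?N s'" "insert {s, m} M = insert {s', m} M'" for M M'
    proof -
      have "{s, m} \<noteq> {s', m}"
        using \<open>s \<noteq> s'\<close> lt[OF \<open>s \<in> S\<close>] by (auto simp: doubleton_eq_iff)
      then have "{s, m} \<in> M'" using that(3) by blast
      then show False using notin[OF \<open>s' \<in> S\<close> that(2)] by blast
    qed
    then show ?thesis by blast
  qed
  have inner: "sum ?w (insert {s, m} ` ?N s) = ?q s * path_sum (card S - 1) n" if s: "s \<in> S" for s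
  proof -
    \<comment> \<open>No edge of a member of \<open>?N s\<close> contains \<open>m\<close>, so the
      added edge can be removed again.\<close>
    have "inj_on (insert {s, m}) (?N s)"
      using notin[OF s] by (intro inj_onI) (metis insertI1 insertI2 insert_ident)
    then have "sum ?w (insert {s, m} ` ?N s) = (\<Sum>M\<in>?N s. ?q s * ?w M)"
      using weight[OF s] by (simp add: sum.reindex)
    also have "\<dots> = ?q s * path_sum (card (S - {s})) n"
      using Suc.IH[of "S - {s}" "Suc m"] fin lt by (simp add: less_Suc_eq flip: sum_distrib_left)
    finally show ?thesis using s by simp
  qed
  have qsum: "sum ?q S = of_nat (card S) - 1 + indet_c" if ne: "S \<noteq> {}"
  proof -
    obtain t where t: "t \<in> S" "\<And>s. s \<in> S \<Longrightarrow> (\<exists>s'\<in>S. Q s s') \<longleftrightarrow> s \<noteq> t"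
      using extremal[OF fin ne] by blast
    have "sum ?q S = ?q t + sum ?q (S - {t})"
      using fin t(1) by (rule sum.remove)
    also have "sum ?q (S - {t}) = (\<Sum>s\<in>S - {t}. 1)"
      using t(2) by (intro sum.cong) auto
    also have "?q t = indet_c" using t by simp
    also have "(\<Sum>s\<in>S - {t}. 1) = (of_nat (card S) - 1 :: int poly)"
      using fin t(1) by (simp add: of_nat_diff card_gt_0_iff Suc_leI ne)
    finally show ?thesis by simp
  qed
  have "completions S m (Suc n) = ?A \<union> ?B"
    using lt by (rule completions_Suc)
  moreover have "sum ?w (?A \<union> ?B) = sum ?w ?A + sum ?w ?B"
    using disj fin finB by (intro sum.union_disjoint) (simp_all add: finite_completions)
  ultimately have "sum ?w (completions S m (Suc n)) = sum ?w ?A + sum ?w ?B"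
    by simp
  also have "sum ?w ?A = path_sum (card (insert m S)) n"
    using fin lt by (intro Suc.IH) (auto simp: less_Suc_eq)
  also have "card (insert m S) = Suc (card S)"
    using fin lt by (intro card_insert_disjoint) auto
  also have "sum ?w ?B = (\<Sum>s\<in>S. sum ?w (insert {s, m} ` ?N s))"
    using fin finB disjB by (intro sum.UNION_disjoint) auto
  also have "\<dots> = sum ?q S * path_sum (card S - 1) n"
    using inner by (simp add: sum_distrib_right)
  \<comment> \<open>For \<open>S = {}\<close> the empty sum of \<open>?q\<close> gives 0, matching
    the absence of a southeast step at height 0.\<close>
  also have "path_sum (Suc (card S)) n + \<dots> = path_sum (card S) (Suc n)"
    using fin qsum by (cases "S = {}") (simp_all add: path_sum_Suc[of _ n])
  finally show ?case .
qed

theorem mainTheorem2: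
  fixes n :: nat
  shows "assoc_hermite_moment n = (\<Sum>M\<in>complete_matchings n. \<Prod>e\<in>M. nesting_weight M e) \<and>
         assoc_hermite_moment n = (\<Sum>M\<in>complete_matchings n. \<Prod>e\<in>M. crossing_weight M e)"
proof
  \<comment> \<open>Height 0 is written as \<open>card {}\<close> to match the induction result at
    \<open>S = {}\<close>.\<close>
  have moment: "assoc_hermite_moment n = path_sum (card ({} :: nat set)) n"
    by (simp add: assoc_hermite_moment_eq_dyck_sum path_sum_def)
  have Min_le_Max: "Min e \<le> Max e" if "card e = 2" for e :: "nat set"
    using that by (auto simp: card_2_iff)
  have "nesting_weight = rel_weight nested_by"
    by (intro ext) (simp add: nesting_weight_def rel_weight_def)
  moreover have "(\<Sum>M\<in>completions {} 1 n. \<Prod>e\<in>M. rel_weight nested_by M e) =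
      path_sum (card ({} :: nat set)) n"
  proof (rule sum_completions_eq_path_sum[where Q = "\<lambda>a b. b < a"])
    \<comment> \<open>The extra conjunct \<open>Min e' < Max e\<close> follows from
      \<open>Min e' < Min e\<close> and \<open>Min e \<le> Max e\<close>.\<close>
    show "nested_by e e' \<longleftrightarrow> Max e < Max e' \<and> Min e' < Max e \<and> Min e' < Min e"
      if "card e = 2" for e e'
      using Min_le_Max[OF that] by (auto simp: nested_by_def)
    show "\<exists>t\<in>S. \<forall>s\<in>S. (\<exists>s'\<in>S. s' < s) \<longleftrightarrow> s \<noteq> t" if "finite S" "S \<noteq> {}" for S :: "nat set"
    proof (intro bexI ballI)
      fix s assume "s \<in> S"
      then show "(\<exists>s'\<in>S. s' < s) \<longleftrightarrow> s \<noteq> Min S"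
        using that by (metis Min_in Min_le le_neq_implies_less not_less)
    qed (use that in simp)
  qed auto
  ultimately show "assoc_hermite_moment n = (\<Sum>M\<in>complete_matchings n. \<Prod>e\<in>M. nesting_weight M e)"
    by (simp only: moment complete_matchings_eq_completions)
  have "crossing_weight = rel_weight right_crossed_by"
    by (intro ext) (simp add: crossing_weight_def rel_weight_def)
  moreover have "(\<Sum>M\<in>completions {} 1 n. \<Prod>e\<in>M. rel_weight right_crossed_by M e) =
      path_sum (card ({} :: nat set)) n"
  proof (rule sum_completions_eq_path_sum[where Q = "(<)"])
    \<comment> \<open>The witness is now \<open>Max S\<close>, where nestings used
      \<open>Min S\<close>.\<close>
    show "\<exists>t\<in>S. \<forall>s\<in>S. (\<exists>s'\<in>S. s < s') \<longleftrightarrow> s \<noteq> t" if "finite S" "S \<noteq> {}" for S :: "nat set"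
    proof (intro bexI ballI)
      fix s assume "s \<in> S"
      then show "(\<exists>s'\<in>S. s < s') \<longleftrightarrow> s \<noteq> Max S"
        using that by (metis Max_in Max_ge le_neq_implies_less not_less)
    qed (use that in simp)
  qed (auto simp: right_crossed_by_def)
  ultimately show "assoc_hermite_moment n = (\<Sum>M\<in>complete_matchings n. \<Prod>e\<in>M. crossing_weight M e)"
    by (simp only: moment complete_matchings_eq_completions)
qed

end
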